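(* Let $\theta\in C^{\omega}(\mathbb{R}/\mathbb{Z},\mathbb{R})$ be nonconstant (real analytic), let $k\in\mathbb{Z}$, and let $v(x)=e^{2\pi i[kx+\theta(x)]}$. Let $\mathcal{F}=\mathcal{F}(\theta,k)\subset\mathbb{R}/\mathbb{Z}\times\partial\mathbb{D}$ be the exceptional finite set described in the context. Then for every $\alpha\in\mathbb{R}/\mathbb{Z}$ with $d(\alpha,\pi_1(\mathcal{F}))>0$ there is a constant $c\in(0,1)$ such that $$L(\alpha,A^{(E,\lambda v)})>0$$ for all $(E,\lambda)\in\partial\mathbb{D}\times(c,1)$.
   Context: $\mathbb{D}$ is the open unit disk in $\mathbb{C}$, $\pi_1:\mathbb{R}/\mathbb{Z}\times\partial\mathbb{D}\to\mathbb{R}/\mathbb{Z}$ is the projection to the first component, and $d$ is the distance on $\mathbb{R}/\mathbb{Z}$. For $E\in\partial\mathbb{D}$ and $\lambda\in(0,1)$, the Szegő cocycle map is $$A^{(E,\lambda v)}(x)=(1-\lambda^2)^{-1/2}\begin{pmatrix}\sqrt E& \frac{-\lambda\overline{v(x)}}{\sqrt E}\\ -\lambda v(x)\sqrt E&\frac{1}{\sqrt E}\end{pmatrix}$$ (the choice of square root changes it only by a sign). For $\alpha\in\mathbb{R}/\mathbb{Z}$ and continuous $A:\mathbb{R}/\mathbb{Z}\to SL(2,\mathbb{C})$, put $A_n(x)=A(x+(n-1)\alpha)\cdots A(x)$ for $n\ge1$, and $L(\alpha,A)=\lim_{n\to\infty}\frac1n\int_{\mathbb{R}/\mathbb{Z}}\ln\|A_n(x)\|\,dx$.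 The set $\mathcal{F}$: let $q(\theta)$ be the largest positive integer $q$ with $\theta(x+\frac1q)=\theta(x)$ for all $x$. The set $\mathcal{F}$ is a finite subset of $\mathbb{R}/\mathbb{Z}\times\partial\mathbb{D}$ with the following properties (such a set exists): (i) $\pi_1(\mathcal{F})\subset\{p/q(\theta):p=0,\ldots,q(\theta)-1\}$; (ii) for every compact $\mathcal{C}\subset(\mathbb{R}/\mathbb{Z}\times\partial\mathbb{D})\setminus\mathcal{F}$ there is $c_0\in\mathbb{R}$, depending only on $\theta,k,\mathcal{C}$, with $L(\alpha,A^{(E,\lambda v)})\ge-\frac12\ln(1-\lambda)+c_0$ for all $(\alpha,E)\in\mathcal{C}$, $\lambda\in(0,1)$; (iii) $L(\alpha,A^{(E,\lambda v)})=0$ for all $(\alpha,E)\in\mathcal{F}$, $\lambda\in(0,1)$. *)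

theory Defs
  imports "HOL-Analysis.Analysis"
begin

quotient_type circle = real / "\<lambda>x y :: real. x - y \<in> \<int>"
  morphisms rep_circle to_circle
proof (rule equivpI)
  show "reflp (\<lambda>x y :: real. x - y \<in> \<int>)"
    by (auto simp: reflp_def)
  show "symp (\<lambda>x y :: real. x - y \<in> \<int>)"
    by (auto simp: symp_def) (metis Ints_minus minus_diff_eq)
  show "transp (\<lambda>x y :: real. x - y \<in> \<int>)"
    by (auto simp: transp_def) (metis Ints_add diff_add_cancel add_diff_eq)
qed

instantiation circle :: ab_group_add
begin

lift_definition zero_circle :: circle is 0 .

lift_definition plus_circle :: "circle \<Rightarrow> circle \<Rightarrow> circle" is "(+)"
  by (metis Ints_add add_diff_add)

lift_definition uminus_circle :: "circle \<Rightarrow> circle" is uminus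
  by (metis Ints_minus minus_diff_minus)

lift_definition minus_circle :: "circle \<Rightarrow> circle \<Rightarrow> circle" is "(-)"
  by (metis Ints_diff diff_diff_eq2 diff_add_eq add_diff_eq add.commute diff_diff_eq)

instance
  by standard (transfer; simp)+

end

lemma infdist_Ints_attained:
  fixes z :: real
  obtains m where "m \<in> \<int>" "infdist z \<int> = dist z m"
proof (rule infdist_attains_inf[OF closed_Ints, of z])
  show "(\<int> :: real set) \<noteq> {}" using Ints_0 by (metis empty_iff)
qed

lemma infdist_Ints_shift:
  fixes z :: real
  assumes "w \<in> \<int>"
  shows "infdist (z + w) \<int> = infdist z \<int>"
proof -
  have *: "infdist (z + w) \<int> \<le> infdist z \<int>" if w: "w \<in> \<int>" for z w :: real
  proof -
    obtain m where m: "m \<in> \<int>" "infdist z \<int> = dist z m"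
      by (rule infdist_Ints_attained)
    have "infdist (z + w) \<int> \<le> dist (z + w) (m + w)"
      using m w by (intro infdist_le) auto
    then show ?thesis using m by simp
  qed
  show ?thesis
    using *[of w z] *[of "- w" "z + w"] assms by simp
qed

instantiation circle :: metric_space
begin

lift_definition dist_circle :: "circle \<Rightarrow> circle \<Rightarrow> real" is "\<lambda>x y. infdist (x - y) \<int>"
proof -
  fix x x' y y' :: real
  assume "x - x' \<in> \<int>" "y - y' \<in> \<int>"
  then have "(x - x') - (y - y') \<in> \<int>" by (rule Ints_diff)
  from infdist_Ints_shift[OF this, of "x' - y'"]
  show "infdist (x - y) \<int> = infdist (x' - y') \<int>" by simp
qed

definition uniformity_circle :: "(circle \<times> circle) filter" where
  "uniformity_circle = (INF e\<in>{0<..}. principal {(x, y). dist x y < e})"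

definition open_circle :: "circle set \<Rightarrow> bool" where
  "open_circle U \<longleftrightarrow> (\<forall>x\<in>U. \<forall>\<^sub>F (x', y) in uniformity. x' = x \<longrightarrow> y \<in> U)"

instance
proof
  fix x y z :: circle
  show "(dist x y = 0) = (x = y)"
    proof transfer
    fix x y :: real
    have "(\<int> :: real set) \<noteq> {}" using Ints_0 by (metis empty_iff)
    from in_closed_iff_infdist_zero[OF closed_Ints this, of "x - y"]
    show "(infdist (x - y) \<int> = 0) = (x - y \<in> \<int>)" by simp
  qed
  show "dist x y \<le> dist x z + dist y z"
  proof transfer
    fix x y z :: real
    obtain m where m: "m \<in> \<int>" "infdist (x - z) \<int> = dist (x - z) m"
      by (rule infdist_Ints_attained)
    obtain n where n: "n \<in> \<int>" "infdist (y - z) \<int> = dist (y - z) n"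
      by (rule infdist_Ints_attained)
    have "infdist (x - y) \<int> \<le> dist (x - y) (m - n)"
      using m n by (intro infdist_le) auto
    also have "\<dots> \<le> dist (x - z) m + dist (y - z) n"
      by (simp add: dist_real_def)
    finally show "infdist (x - y) \<int> \<le> infdist (x - z) \<int> + infdist (y - z) \<int>"
      using m n by simp
  qed
next
  show "(uniformity :: (circle \<times> circle) filter) =
      (INF e\<in>{0<..}. principal {(x, y). dist x y < e})"
    by (rule uniformity_circle_def)
next
  fix U :: "circle set"
  show "open U \<longleftrightarrow> (\<forall>x\<in>U. \<forall>\<^sub>F (x', y) in uniformity. x' = x \<longrightarrow> y \<in> U)"
    by (rule open_circle_def)
qed

end

text \<open>
  Distance to a set of points, with the usual convention that the infimum over the empty set
  is \<open>\<infinity>\<close> (the library's \<open>infdist\<close> is \<open>0\<close> there).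
\<close>

definition dist_to_set :: "circle \<Rightarrow> circle set \<Rightarrow> ereal" where
  "dist_to_set x S = (INF y\<in>S. ereal (dist x y))"

definition circle_integral :: "(circle \<Rightarrow> real) \<Rightarrow> real" where
  "circle_integral f = (LBINT t:{0..<1}. f (to_circle t))"

definition real_analytic_circle :: "(circle \<Rightarrow> real) \<Rightarrow> bool" where
  "real_analytic_circle f \<longleftrightarrow>
     (\<forall>t. \<exists>P. (\<lambda>h. f (to_circle (t + h))) has_fps_expansion P)"

primrec cocycle_iter ::
  "circle \<Rightarrow> (circle \<Rightarrow> complex^2^2) \<Rightarrow> nat \<Rightarrow> circle \<Rightarrow> complex^2^2" where
  "cocycle_iter \<alpha> A 0 x = mat 1"
| "cocycle_iter \<alpha> A (Suc n) x = A (((\<lambda>y. y + \<alpha>) ^^ n) x) ** cocycle_iter \<alpha> A n x"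

text \<open>
  The matrix norm is the operator norm; \<open>norm\<close> on \<open>complex^2^2\<close> would be the Frobenius norm.
\<close>

definition lyapunov :: "circle \<Rightarrow> (circle \<Rightarrow> complex^2^2) \<Rightarrow> real" where
  "lyapunov \<alpha> A =
     lim (\<lambda>n. 1 / real n * circle_integral (\<lambda>x. ln (onorm ((*v) (cocycle_iter \<alpha> A n x)))))"

text \<open>
  The value of \<open>kx\<close> modulo \<open>\<int>\<close> does not depend on the representative of \<open>x\<close>.
\<close>

definition sampling :: "(circle \<Rightarrow> real) \<Rightarrow> int \<Rightarrow> circle \<Rightarrow> complex" where
  "sampling \<theta> k x =
     exp (2 * of_real pi * \<i> * of_real (of_int k * rep_circle x + \<theta> x))"

lemma sampling_to_circle:
  "sampling \<theta> k (to_circle t) =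
     exp (2 * of_real pi * \<i> * of_real (of_int k * t + \<theta> (to_circle t)))"
proof -
  have "to_circle (rep_circle (to_circle t)) = to_circle t"
    by (rule Quotient3_abs_rep[OF Quotient3_circle])
  then have "rep_circle (to_circle t) - t \<in> \<int>"
    by (simp add: circle.abs_eq_iff)
  then obtain m where m: "rep_circle (to_circle t) = t + of_int m"
    by (metis Ints_cases add.commute diff_eq_eq)
  show ?thesis
    unfolding sampling_def m exp_eq
    by (rule exI[of _ "k * m"]) (simp add: algebra_simps)
qed

definition szego_map ::
  "complex \<Rightarrow> real \<Rightarrow> (circle \<Rightarrow> complex) \<Rightarrow> circle \<Rightarrow> complex^2^2" where
  "szego_map E lam v x = ((1 - lam\<^sup>2) powr (- 1 / 2)) *\<^sub>R
     vector [vector [csqrt E, - of_real lam * cnj (v x) / csqrt E],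
             vector [- of_real lam * v x * csqrt E, 1 / csqrt E]]"

definition largest_period :: "(circle \<Rightarrow> real) \<Rightarrow> nat" where
  "largest_period \<theta> = (GREATEST q. 0 < q \<and> (\<forall>x. \<theta> (x + to_circle (1 / real q)) = \<theta> x))"

definition exceptional_set ::
  "(circle \<Rightarrow> real) \<Rightarrow> int \<Rightarrow> (circle \<times> complex) set \<Rightarrow> bool" where
  "exceptional_set \<theta> k F \<longleftrightarrow>
     finite F \<and> F \<subseteq> UNIV \<times> sphere 0 1 \<and>
     fst ` F \<subseteq> {to_circle (real p / real (largest_period \<theta>)) | p. p < largest_period \<theta>} \<and>
     (\<forall>C. compact C \<and> C \<subseteq> (UNIV \<times> sphere 0 1) - F \<longrightarrow>
        (\<exists>c0. \<forall>(\<alpha>, E)\<in>C. \<forall>lam\<in>{0<..<1}.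
           lyapunov \<alpha> (szego_map E lam (sampling \<theta> k)) \<ge> - (1 / 2) * ln (1 - lam) + c0)) \<and>
     (\<forall>(\<alpha>, E)\<in>F. \<forall>lam\<in>{0<..<1}. lyapunov \<alpha> (szego_map E lam (sampling \<theta> k)) = 0)"

text \<open>
  The defining properties determine the set, so speaking of ``the'' exceptional set
  is unambiguous.
\<close>

lemma exceptional_set_unique:
  assumes F: "exceptional_set \<theta> k F" and G: "exceptional_set \<theta> k G"
  shows "F = G"
proof -
  have sub: "F \<subseteq> G" if F: "exceptional_set \<theta> k F" and G: "exceptional_set \<theta> k G" for F G
  proof
    fix p assume p: "p \<in> F"
    obtain \<alpha> E where pE: "p = (\<alpha>, E)" by (cases p)
    show "p \<in> G"
    proof (rule ccontr)
      assume "p \<notin> G"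
      then have "compact {p} \<and> {p} \<subseteq> (UNIV \<times> sphere 0 1) - G"
        using F p unfolding exceptional_set_def by auto
      then have "\<exists>c0. \<forall>(\<alpha>, E)\<in>{p}. \<forall>lam\<in>{0<..<1}.
          lyapunov \<alpha> (szego_map E lam (sampling \<theta> k)) \<ge> - (1 / 2) * ln (1 - lam) + c0"
        using G unfolding exceptional_set_def by blast
      then have "\<exists>c0. \<forall>lam\<in>{0<..<1}.
          lyapunov \<alpha> (szego_map E lam (sampling \<theta> k)) \<ge> - (1 / 2) * ln (1 - lam) + c0"
        by (simp only: pE ball_simps case_prod_conv simp_thms)
      then obtain c0 where c0: "\<And>lam. lam \<in> {0<..<1} \<Longrightarrow>
          lyapunov \<alpha> (szego_map E lam (sampling \<theta> k)) \<ge> - (1 / 2) * ln (1 - lam) + c0"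
        by (elim exE) (rule that, drule (1) bspec)
      define lam where "lam = 1 - exp (- (2 * \<bar>c0\<bar> + 1))"
      have lam: "lam \<in> {0<..<1}" by (simp add: lam_def)
      have "lyapunov \<alpha> (szego_map E lam (sampling \<theta> k)) = 0"
        using F p lam unfolding exceptional_set_def pE
        by (elim conjE) (drule (1) bspec, simp)
      moreover have "- (1 / 2) * ln (1 - lam) + c0 > 0"
        by (simp add: lam_def)
      ultimately show False using c0[OF lam] by simp
    qed
  qed
  from sub[OF F G] sub[OF G F] show ?thesis by blast
qed

end

theory Submission
  imports Defs
begin

text \<open>
  The point is that the constant in the lower bound defining the exceptional set is uniform over
  compact sets. A frequency at positive distance from the projection of \<open>F\<close> is not a first
  component of \<open>F\<close>, so the whole fibre above it, a compact circle of spectral parameters,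
  avoids \<open>F\<close>. On this fibre a single constant \<open>c0\<close> gives
  \<open>L \<ge> - (1 / 2) * ln (1 - lam) + c0\<close>, and as \<open>lam\<close> tends to 1 the logarithm outweighs
  \<open>c0\<close>, from a threshold on that depends on \<open>c0\<close> alone and hence not on \<open>E\<close>.
\<close>

lemma dist_to_set_pos_imp_not_mem:
  assumes "dist_to_set \<alpha> S > 0"
  shows "\<alpha> \<notin> S"
proof
  assume "\<alpha> \<in> S"
  then have "dist_to_set \<alpha> S \<le> ereal (dist \<alpha> \<alpha>)"
    unfolding dist_to_set_def by (rule INF_lower)
  with assms show False by (simp add: zero_ereal_def)
qed

lemma log_bound_eventually_pos:
  fixes c0 :: real
  obtains c where "c \<in> {0<..<1}"
    and "\<And>lam. lam \<in> {c<..<1} \<Longrightarrow> - (1 / 2) * ln (1 - lam) + c0 > 0"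
proof
  \<comment> \<open>At \<open>lam = 1 - exp (- 2 * a)\<close> the logarithmic term equals \<open>a\<close>; the choice
    \<open>a = \<bar>c0\<bar> + 1\<close> beats \<open>- c0\<close> and is positive, which puts the threshold inside the
    open unit interval.\<close>
  define c where "c = 1 - exp (- 2 * (\<bar>c0\<bar> + 1))"
  show "c \<in> {0<..<1}" by (simp add: c_def)
  fix lam assume lam: "lam \<in> {c<..<1}"
  then have "1 - lam < exp (- 2 * (\<bar>c0\<bar> + 1))" by (simp add: c_def)
  with lam have "ln (1 - lam) < ln (exp (- 2 * (\<bar>c0\<bar> + 1)))"
    by (subst ln_less_cancel_iff) auto
  then have "ln (1 - lam) < - 2 * (\<bar>c0\<bar> + 1)" by simp
  then show "- (1 / 2) * ln (1 - lam) + c0 > 0" by argo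
qed

theorem corollary4:
  fixes \<theta> :: "circle \<Rightarrow> real" and k :: int and F :: "(circle \<times> complex) set" and \<alpha> :: circle
  assumes "real_analytic_circle \<theta>"
    and "\<not> \<theta> constant_on UNIV"
    and "exceptional_set \<theta> k F"
    and "dist_to_set \<alpha> (fst ` F) > 0"
  shows "\<exists>c\<in>{0<..<1}. \<forall>E\<in>sphere 0 1. \<forall>lam\<in>{c<..<1}.
           lyapunov \<alpha> (szego_map E lam (sampling \<theta> k)) > 0"
proof -
  let ?fibre = "{\<alpha>} \<times> sphere (0 :: complex) 1"
  have "\<alpha> \<notin> fst ` F" using assms(4) by (rule dist_to_set_pos_imp_not_mem)
  then have "?fibre \<subseteq> (UNIV \<times> sphere 0 1) - F" by force
  moreover have "compact ?fibre" by (intro compact_Times) auto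
  ultimately have "\<exists>c0. \<forall>(\<alpha>, E)\<in>?fibre. \<forall>lam\<in>{0<..<1}.
      lyapunov \<alpha> (szego_map E lam (sampling \<theta> k)) \<ge> - (1 / 2) * ln (1 - lam) + c0"
    using assms(3) unfolding exceptional_set_def by blast
  then obtain c0 where "\<forall>(\<alpha>, E)\<in>?fibre. \<forall>lam\<in>{0<..<1}.
      lyapunov \<alpha> (szego_map E lam (sampling \<theta> k)) \<ge> - (1 / 2) * ln (1 - lam) + c0"
    by (rule exE)
  then have bound: "lyapunov \<alpha> (szego_map E lam (sampling \<theta> k)) \<ge> - (1 / 2) * ln (1 - lam) + c0"
    if "E \<in> sphere 0 1" "lam \<in> {0<..<1}" for E lam
    using that by blast
  obtain c where c: "c \<in> {0<..<1}"
    and pos: "\<And>lam. lam \<in> {c<..<1} \<Longrightarrow> - (1 / 2) * ln (1 - lam) + c0 > 0"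
    by (rule log_bound_eventually_pos[of c0]) (rule that)
  have "lyapunov \<alpha> (szego_map E lam (sampling \<theta> k)) > 0"
    if "E \<in> sphere 0 1" "lam \<in> {c<..<1}" for E lam
  proof -
    have "lam \<in> {0<..<1}" using c that(2) by auto
    from pos[OF that(2)] bound[OF that(1) this] show ?thesis by (rule less_le_trans)
  qed
  with c show ?thesis by blast
qed

end
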